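(* Let $k\geq 16$ or $k\in\{12,13\}$. Then the set of odd positive integers $n$ with $s_2(n^2)=s_2(n)=k$ is infinite.
   Context: $s_2(m)$ denotes the sum of the binary digits of the nonnegative integer $m$. *)

theory Defs
  imports Main
begin

fun s2 :: "nat \<Rightarrow> nat" where
  "s2 m = (if m = 0 then 0 else m mod 2 + s2 (m div 2))"

(* The defining equation rewrites its own right-hand side, so it loops as a simp rule. *)
declare s2.simps [simp del]

lemma s2_eq_sum_digits: "m < 2 ^ L \<Longrightarrow> s2 m = (\<Sum>i<L. (m div 2 ^ i) mod 2)"
proof (induction L arbitrary: m)
  case 0
  then show ?case by (simp add: s2.simps)
next
  case (Suc L)
  have "m div 2 < 2 ^ L"
    using Suc.prems by simp
  then have "s2 (m div 2) = (\<Sum>i<L. (m div 2 ^ Suc i) mod 2)"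
    by (simp add: Suc.IH div_mult2_eq)
  then show ?case
    by (subst s2.simps) (simp add: sum.lessThan_Suc_shift del: sum.lessThan_Suc)
qed

end

theory Submission
  imports Defs
begin

text \<open>
  If \<open>r\<close> is large, the three terms of \<open>(a + 2^r b)^2 = a^2 + 2^(r+1) a b + 2^(2r) b^2\<close> do not
  interfere in binary. Hence one pair \<open>(a, b)\<close> with \<open>a\<close> odd and
  \<open>s2 (a^2) + s2 (a b) + s2 (b^2) = s2 a + s2 b = k\<close> gives infinitely many \<open>n = a + 2^r b\<close>.
  Numbers \<open>a = 2^p - 2^q - 1\<close> with \<open>p/2 < q < p\<close> have \<open>s2 a = p - 1\<close> but only \<open>s2 (a^2) = q\<close>.
  For \<open>b = 2^(p+e) - 2^(q+d) - 1\<close> with small \<open>e \<le> d\<close> one finds \<open>s2 (a b) = q + d + 1\<close>, so the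
  condition on the pair is the linear equation \<open>3 q + 2 d + 1 = 2 p + e - 2 = k\<close>, which is solvable
  for all \<open>k \<ge> 29\<close>. For the remaining \<open>k\<close> there are explicit pairs.
\<close>

section \<open>Digit sums of concatenated binary blocks\<close>

lemma s2_0 [simp]: "s2 0 = 0"
  by (simp add: s2.simps)

lemma s2_double [simp]: "s2 (2 * n) = s2 n"
  by (cases "n = 0") (simp_all add: s2.simps[of "2 * n"])

lemma s2_Suc_double [simp]: "s2 (Suc (2 * n)) = Suc (s2 n)"
  by (simp add: s2.simps[of "Suc (2 * n)"])

lemma s2_1 [simp]: "s2 (Suc 0) = 1"
  using s2_Suc_double[of 0] by simp

text \<open>Lets the simplifier evaluate \<open>s2\<close> on literals bit by bit, which is how the
  explicit pairs are verified.\<close>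

lemma s2_numeral [simp]:
  "s2 (numeral Num.One) = 1"
  "s2 (numeral (Num.Bit0 m)) = s2 (numeral m)"
  "s2 (numeral (Num.Bit1 m)) = Suc (s2 (numeral m))"
  using s2_double[of "numeral m"] s2_Suc_double[of "numeral m"]
  by (simp_all add: numeral_Bit0 numeral_Bit1 mult_2)

text \<open>The low block only occupies positions below \<open>r\<close>, so no carry occurs. All
  digit counts below split numbers in this way.\<close>

lemma s2_append: "x < 2 ^ r \<Longrightarrow> s2 (x + 2 ^ r * y) = s2 x + s2 y"
proof (induction r arbitrary: x)
  case 0
  then show ?case by simp
next
  case (Suc r)
  have half: "x div 2 < 2 ^ r"
    using Suc.prems by simp
  show ?case
  proof (cases "even x")
    case True
    then obtain z where z: "x = 2 * z" by (elim evenE)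
    then have "x + 2 ^ Suc r * y = 2 * (z + 2 ^ r * y)"
      by (simp add: algebra_simps)
    then have "s2 (x + 2 ^ Suc r * y) = s2 (z + 2 ^ r * y)"
      by (simp only: s2_double)
    then show ?thesis
      using Suc.IH[OF half] z by simp
  next
    case False
    then obtain z where z: "x = Suc (2 * z)" by (auto elim!: oddE)
    then have "x + 2 ^ Suc r * y = Suc (2 * (z + 2 ^ r * y))"
      by (simp add: algebra_simps)
    then have "s2 (x + 2 ^ Suc r * y) = Suc (s2 (z + 2 ^ r * y))"
      by (simp only: s2_Suc_double)
    then show ?thesis
      using Suc.IH[OF half] z by simp
  qed
qed

lemma s2_Suc_append: "r > 0 \<Longrightarrow> s2 (1 + 2 ^ r * y) = Suc (s2 y)"
  using s2_append[of 1 r y] one_less_power[of "2 :: nat" r] by simp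

lemma s2_ones: "s2 (2 ^ j - 1) = j"
proof (induction j)
  case 0
  then show ?case by simp
next
  case (Suc j)
  have "(2 ^ Suc j - 1 :: nat) = Suc (2 * (2 ^ j - 1))"
    using one_le_power[of "2 :: nat" j] by (simp, linarith)
  then show ?case
    using Suc.IH by (simp only: s2_Suc_double)
qed

section \<open>Numbers whose binary expansion has a single hole\<close>

lemma int_hole:
  assumes "l < m"
  shows "int (2 ^ m - 2 ^ l - 1) = 2 ^ m - 2 ^ l - 1"
proof -
  have "(2 ^ l :: nat) < 2 ^ m"
    using assms by simp
  then show ?thesis
    by (simp add: of_nat_diff Suc_le_eq)
qed

lemma int_ones: "int (2 ^ j - 1) = 2 ^ j - 1"
  by (simp add: of_nat_diff)

text \<open>In binary this is a run of \<open>m\<close> ones with the one at position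
  \<open>l\<close> erased.\<close>

lemma s2_hole:
  assumes "l < m"
  shows "s2 (2 ^ m - 2 ^ l - 1) = m - 1"
proof -
  obtain i where m: "m = l + 1 + i"
    using assms less_iff_Suc_add[of l m] by auto
  \<comment> \<open>Truncated subtraction obstructs ring identities, so the splitting is checked
    over the integers.\<close>
  have "int (2 ^ m - 2 ^ l - 1) = int ((2 ^ l - 1) + 2 ^ (l + 1) * (2 ^ i - 1))"
    unfolding int_hole[OF assms] of_nat_add of_nat_mult int_ones
    by (simp add: m power_add algebra_simps)
  then have eq: "2 ^ m - 2 ^ l - 1 = (2 ^ l - 1 :: nat) + 2 ^ (l + 1) * (2 ^ i - 1)"
    by (simp only: of_nat_eq_iff)
  have "(2 ^ l - 1 :: nat) < 2 ^ (l + 1)"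
    by (rule le_less_trans[of _ "2 ^ l"]) simp_all
  then show ?thesis
    unfolding eq by (simp only: s2_append s2_ones) (simp add: m)
qed

text \<open>The square is \<open>1 + 2^(q+1) + (2^(2*q) - 2^(p+1)) + (2^(2*p) - 2^(p+q+1))\<close>,
  with disjoint blocks. The differences are runs of \<open>2*q-p-1\<close> and \<open>p-q-1\<close>
  ones.\<close>

lemma s2_hole_square:
  assumes "q < p" and "p < 2 * q"
  shows "s2 ((2 ^ p - 2 ^ q - 1)\<^sup>2) = q"
proof -
  define i where "i = p - q - 1"
  define j where "j = 2 * q - p - 1"
  have q: "q = i + j + 2" and p: "p = 2 * i + j + 3"
    using assms by (simp_all add: i_def j_def)
  let ?y = "(2 ^ j - 1) + 2 ^ q * (2 ^ i - 1) :: nat"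
  have powers: "(2 ^ p :: int) = 8 * 2 ^ i * 2 ^ i * 2 ^ j" "(2 ^ q :: int) = 4 * 2 ^ i * 2 ^ j"
    by (simp_all add: p q power_add power_even_eq power2_eq_square)
  have "int ((2 ^ p - 2 ^ q - 1)\<^sup>2) = int (1 + 2 ^ (q + 1) * (1 + 2 ^ (i + 1) * ?y))"
    unfolding of_nat_add of_nat_mult of_nat_power int_hole[OF assms(1)] int_ones
    by (simp add: powers power_add algebra_simps power2_eq_square)
  then have eq: "(2 ^ p - 2 ^ q - 1)\<^sup>2 = 1 + 2 ^ (q + 1) * (1 + 2 ^ (i + 1) * ?y)"
    by (simp only: of_nat_eq_iff)
  have "(2 ^ j :: nat) \<le> 2 ^ q"
    by (rule power_increasing) (simp_all add: q)
  then have "(2 ^ j - 1 :: nat) < 2 ^ q"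
    by (rule less_le_trans[rotated]) simp
  then have "s2 ?y = i + j"
    by (simp only: s2_append s2_ones add.commute)
  then show ?thesis
    unfolding eq by (simp add: s2_Suc_append q del: power_Suc One_nat_def)
qed

text \<open>The product is \<open>1 + 2^q + 2^(q+d)\<close> plus two higher disjoint blocks,
  \<open>2^p * (2^y - 2^e - 1)\<close> and \<open>2^(p+q+e) * (2^x - 2^f - 1)\<close>, which are
  again runs with one hole. The count is \<open>3 + (y-1) + (x-1)\<close>.\<close>

lemma s2_hole_mult:
  assumes "0 < d" and "e \<le> d" and "q + d < p" and "p + e < 2 * q + d"
  shows "s2 ((2 ^ p - 2 ^ q - 1) * (2 ^ (p + e) - 2 ^ (q + d) - 1)) = q + d + 1"
proof -
  define x where "x = p - q"
  define y where "y = 2 * q + d - p"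
  define f where "f = d - e"
  define g where "g = p - q - d"
  have d: "d = e + f" and p: "p = q + e + f + g" and x: "x = e + f + g" and q: "q = y + g"
    using assms by (simp_all add: x_def y_def f_def g_def)
  have lt: "f < x" "e < y" "0 < g" "0 < q" "q < p" "q + d < p + e"
    using assms by (simp_all add: x_def y_def f_def g_def)
  let ?z = "(2 ^ y - 2 ^ e - 1) + 2 ^ (q + e) * (2 ^ x - 2 ^ f - 1) :: nat"
  have "int ((2 ^ p - 2 ^ q - 1) * (2 ^ (p + e) - 2 ^ (q + d) - 1))
      = int (1 + 2 ^ q * (1 + 2 ^ d * (1 + 2 ^ g * ?z)))"
    unfolding of_nat_add of_nat_mult of_nat_power int_hole[OF lt(1)] int_hole[OF lt(2)]
      int_hole[OF lt(5)] int_hole[OF lt(6)]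
    by (simp add: p d x q power_add algebra_simps)
  then have eq: "(2 ^ p - 2 ^ q - 1) * (2 ^ (p + e) - 2 ^ (q + d) - 1)
      = 1 + 2 ^ q * (1 + 2 ^ d * (1 + 2 ^ g * ?z))"
    by (simp only: of_nat_eq_iff)
  have "(2 ^ y :: nat) \<le> 2 ^ (q + e)"
    by (rule power_increasing) (simp_all add: q)
  then have "(2 ^ y - 2 ^ e - 1 :: nat) < 2 ^ (q + e)"
    by (rule less_le_trans[rotated]) simp
  then have "s2 ?z = (y - 1) + (x - 1)"
    using lt by (simp only: s2_append s2_hole)
  then show ?thesis
    unfolding eq using lt assms(1)
    by (simp add: s2_Suc_append x q d del: power_Suc One_nat_def)
qed

section \<open>From one pair to infinitely many numbers\<close>

definition good_pair :: "nat \<Rightarrow> nat \<Rightarrow> nat \<Rightarrow> bool" where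
  "good_pair k a b \<longleftrightarrow> odd a \<and> 0 < b \<and> s2 a + s2 b = k \<and> s2 (a\<^sup>2) + s2 (a * b) + s2 (b\<^sup>2) = k"

lemma s2_shifted_sum:
  assumes "0 < r" and "a < 2 ^ r" and "a\<^sup>2 < 2 ^ Suc r" and "2 * (a * b) < 2 ^ r"
  shows "s2 (a + 2 ^ r * b) = s2 a + s2 b"
    and "s2 ((a + 2 ^ r * b)\<^sup>2) = s2 (a\<^sup>2) + s2 (a * b) + s2 (b\<^sup>2)"
proof -
  show "s2 (a + 2 ^ r * b) = s2 a + s2 b"
    using assms(2) by (rule s2_append)
  obtain t where r: "r = Suc t"
    using assms(1) by (cases r) simp_all
  have eq: "(a + 2 ^ r * b)\<^sup>2 = a\<^sup>2 + 2 ^ Suc r * (a * b + 2 ^ t * b\<^sup>2)"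
    by (simp add: r power2_eq_square algebra_simps)
  have "a * b < 2 ^ t"
    using assms(4) by (simp add: r)
  then show "s2 ((a + 2 ^ r * b)\<^sup>2) = s2 (a\<^sup>2) + s2 (a * b) + s2 (b\<^sup>2)"
    unfolding eq using assms(3) by (simp only: s2_append add.assoc)
qed

lemma good_pair_infinite:
  assumes "good_pair k a b"
  shows "infinite {n. n > 0 \<and> odd n \<and> s2 (n\<^sup>2) = k \<and> s2 n = k}"
proof -
  have ab: "odd a" "0 < b" "s2 a + s2 b = k" "s2 (a\<^sup>2) + s2 (a * b) + s2 (b\<^sup>2) = k"
    using assms by (simp_all add: good_pair_def)
  \<comment> \<open>Since \<open>r < 2 ^ r\<close>, every \<open>r\<close> from \<open>R\<close> on
    meets all size bounds of \<open>s2_shifted_sum\<close>.\<close>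
  define R where "R = Suc (a + a\<^sup>2 + 2 * (a * b))"
  let ?f = "\<lambda>r. a + 2 ^ r * b"
  have "inj_on ?f {R..}"
    using ab(2) by (auto simp: inj_on_def)
  then have "infinite (?f ` {R..})"
    by (simp add: finite_image_iff infinite_Ici)
  moreover have "?f ` {R..} \<subseteq> {n. n > 0 \<and> odd n \<and> s2 (n\<^sup>2) = k \<and> s2 n = k}"
  proof clarify
    fix r assume "R \<le> r"
    have "r < 2 ^ r"
      by (rule less_exp)
    with \<open>R \<le> r\<close> have "a < 2 ^ r" "a\<^sup>2 < 2 ^ Suc r" "2 * (a * b) < 2 ^ r" "0 < r"
      unfolding R_def power_Suc by linarith+
    moreover from ab(1) have "0 < a"
      by (rule odd_pos)
    ultimately show "?f r > 0 \<and> odd (?f r) \<and> s2 ((?f r)\<^sup>2) = k \<and> s2 (?f r) = k"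
      using ab by (simp add: s2_shifted_sum)
  qed
  ultimately show ?thesis
    using infinite_super by blast
qed

section \<open>Pairs for every admissible exponent sum\<close>

lemma good_pair_holes:
  assumes "0 < d" and "e \<le> d" and "q + d < p" and "p + e < 2 * q + d"
    and "p < 2 * q" and "k = 3 * q + 2 * d + 1" and "k + 2 = 2 * p + e"
  shows "good_pair k (2 ^ p - 2 ^ q - 1) (2 ^ (p + e) - 2 ^ (q + d) - 1)"
proof -
  have lt: "q < p" "p < 2 * q" "q + d < p + e" "p + e < 2 * (q + d)" "0 < q"
    using assms by simp_all
  have "odd (2 ^ p - 2 ^ q - 1 :: nat)"
    using lt by (simp add: not_less Suc_le_eq)
  \<comment> \<open>A nonzero digit sum shows that the second number is positive.\<close>
  moreover have "s2 (2 ^ (p + e) - 2 ^ (q + d) - 1) = p + e - 1"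
    using lt by (intro s2_hole)
  then have "0 < (2 ^ (p + e) - 2 ^ (q + d) - 1 :: nat)"
    using lt by (intro gr0I) simp
  ultimately show ?thesis
    unfolding good_pair_def
    using lt assms by (simp add: s2_hole s2_hole_square s2_hole_mult del: One_nat_def diff_diff_left)
qed

text \<open>Raising \<open>q\<close> by 2 and \<open>p\<close> by 3 adds 6 to both sides of
  \<open>3*q + 2*d + 1 = 2*p + e - 2\<close> and preserves the inequalities. So one base solution
  per residue mod 6 suffices.\<close>

lemma good_pair_large:
  assumes "29 \<le> k"
  shows "\<exists>a b. good_pair k a b"
proof -
  define t where "t = (k - 29) div 6"
  have "k = 6 * t + (29 + (k - 29) mod 6)"
    using assms by (simp add: t_def)
  moreover have "29 + (k - 29) mod 6 \<in> {29..<35}"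
    by simp
  then have "29 + (k - 29) mod 6 \<in> {29, 30, 31, 32, 33, 34}"
    by (simp only: atLeastLessThan_upt) (simp add: upt_rec_numeral del: set_upt)
  ultimately have "k \<in> {6 * t + 29, 6 * t + 30, 6 * t + 31, 6 * t + 32, 6 * t + 33, 6 * t + 34}"
    by (metis (no_types, lifting) insert_iff empty_iff)
  then show ?thesis
  \<comment> \<open>The instantiations give \<open>d\<close>, \<open>e\<close>, \<open>q\<close>,
    \<open>p\<close> in this order.\<close>
  proof (elim insertE)
    assume "k = 6 * t + 29"
    then show ?thesis
      by (intro exI) (rule good_pair_holes[of 2 1 "8 + 2 * t" "15 + 3 * t"]; simp)
  next
    assume "k = 6 * t + 30"
    then show ?thesis
      by (intro exI) (rule good_pair_holes[of 1 0 "9 + 2 * t" "16 + 3 * t"]; simp)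
  next
    assume "k = 6 * t + 31"
    then show ?thesis
      by (intro exI) (rule good_pair_holes[of 3 3 "8 + 2 * t" "15 + 3 * t"]; simp)
  next
    assume "k = 6 * t + 32"
    then show ?thesis
      by (intro exI) (rule good_pair_holes[of 2 2 "9 + 2 * t" "16 + 3 * t"]; simp)
  next
    assume "k = 6 * t + 33"
    then show ?thesis
      by (intro exI) (rule good_pair_holes[of 1 1 "10 + 2 * t" "17 + 3 * t"]; simp)
  next
    assume "k = 6 * t + 34"
    then show ?thesis
      by (intro exI) (rule good_pair_holes[of 3 2 "9 + 2 * t" "17 + 3 * t"]; simp)
  qed simp
qed

text \<open>Each pair is checked by evaluation. For 12, \<open>111 = 2^7 - 2^4 - 1\<close> has digit
  sum 6 and its square has digit sum 4, and \<open>6 + 6 = 4 + 4 + 4\<close>.\<close>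

lemma good_pair_small:
  "good_pair 12 111 111" "good_pair 13 23 1471" "good_pair 16 47 6015"
  "good_pair 17 479 1471" "good_pair 18 47 28415" "good_pair 19 95 24319"
  "good_pair 20 191 28415" "good_pair 21 887 28415" "good_pair 22 447 32255"
  "good_pair 23 959 31743" "good_pair 24 6015 16127" "good_pair 25 7679 24063"
  "good_pair 26 7935 32511" "good_pair 27 16127 32255" "good_pair 28 16127 65023"
  by (simp_all add: good_pair_def power2_eq_square)

theorem theorem1p4:
  fixes k :: nat
  assumes "k \<ge> 16 \<or> k \<in> {12, 13}"
  shows "infinite {n :: nat. n > 0 \<and> odd n \<and> s2 (n\<^sup>2) = k \<and> s2 n = k}"
proof -
  consider "29 \<le> k" | "k \<in> {12, 13}" | "k \<in> {16..<29}"
    using assms by force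
  then have "\<exists>a b. good_pair k a b"
  proof cases
    case 1
    then show ?thesis by (rule good_pair_large)
  next
    case 2
    then show ?thesis
      using good_pair_small by blast
  next
    case 3
    then have "k \<in> {16, 17, 18, 19, 20, 21, 22, 23, 24, 25, 26, 27, 28}"
      by (simp only: atLeastLessThan_upt) (simp add: upt_rec_numeral del: set_upt)
    then show ?thesis
      using good_pair_small by blast
  qed
  then show ?thesis
    using good_pair_infinite by blast
qed

end
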